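(* Let $d\ge 1$ be an integer and let $P$ be an origin-symmetric convex polytope in $\mathbb{R}^d$ with at most $$\frac{4d}{3}-\frac{1+\sqrt{8d+9}}{6}$$ opposite pairs of facets. If $X$ is a $d$-dimensional real normed space with $P$ as its unit ball, then $e(X)\geq d+1$.
   Context: For a normed space $(X,\|\cdot\|)$ and $c>0$, a set $S\subseteq X$ is called $c$-equilateral if $\|x-y\|=c$ for all distinct $x,y\in S$; $S$ is called equilateral if it is $c$-equilateral for some $c>0$. The equilateral number $e(X)$ is the cardinality of the largest equilateral set in $X$. Facets of an origin-symmetric $d$-polytope $P$ (faces of dimension $d-1$) come in opposite pairs $\{F,-F\}$; the number of opposite pairs of facets is half the number of facets. *)

theory Defs
  imports "HOL-Analysis.Analysis" "HOL-Library.Extended_Nat"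
begin

text \<open>Norms are explicit functions, since the space \<open>real ^ 'n\<close> already carries the Euclidean
  norm through its type class.\<close>

definition is_norm :: "('a::real_vector \<Rightarrow> real) \<Rightarrow> bool" where
  "is_norm N \<longleftrightarrow>
     (\<forall>x. 0 \<le> N x) \<and>
     (\<forall>x. N x = 0 \<longleftrightarrow> x = 0) \<and>
     (\<forall>a x. N (a *\<^sub>R x) = \<bar>a\<bar> * N x) \<and>
     (\<forall>x y. N (x + y) \<le> N x + N y)"

definition norm_unit_ball :: "('a::real_vector \<Rightarrow> real) \<Rightarrow> 'a set" where
  "norm_unit_ball N = {x. N x \<le> 1}"

definition c_equilateral :: "('a::real_vector \<Rightarrow> real) \<Rightarrow> real \<Rightarrow> 'a set \<Rightarrow> bool" where
  "c_equilateral N c S \<longleftrightarrow> (\<forall>x\<in>S. \<forall>y\<in>S. x \<noteq> y \<longrightarrow> N (x - y) = c)"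

definition equilateral :: "('a::real_vector \<Rightarrow> real) \<Rightarrow> 'a set \<Rightarrow> bool" where
  "equilateral N S \<longleftrightarrow> (\<exists>c>0. c_equilateral N c S)"

text \<open>Subsets of equilateral sets are equilateral, so the supremum over finite equilateral sets
  is the largest cardinality, and is \<open>\<infinity>\<close> if there are arbitrarily large or infinite ones.\<close>

definition equilateral_number :: "('a::real_vector \<Rightarrow> real) \<Rightarrow> enat" where
  "equilateral_number N = (SUP S \<in> {S. finite S \<and> equilateral N S}. enat (card S))"

definition origin_symmetric :: "'a::real_vector set \<Rightarrow> bool" where
  "origin_symmetric P \<longleftrightarrow> uminus ` P = P"

definition opposite_facet_pairs :: "'a::euclidean_space set \<Rightarrow> 'a set set set" where
  "opposite_facet_pairs P = {{F, uminus ` F} | F. F facet_of P}"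

end

theory Submission
  imports Defs
begin

text \<open>
  Choosing one normal vector from each opposite pair of facets writes the norm as
  \<open>N x = max {\<bar>f \<bullet> x\<bar> | f \<in> F}\<close> with a set \<open>F\<close> of \<open>n\<close> vectors spanning the space, where
  \<open>n\<close> is at most the number of facet pairs (\<open>facet_normals_of_unit_ball\<close>). So the space is a
  subspace of codimension \<open>n - d\<close> of \<open>\<real>\<^sup>F\<close> with the maximum norm, and in all of \<open>\<real>\<^sup>F\<close> the
  vertices of a cube are equilateral. The task is to imitate some of these vertices in the subspace.

  A point of the space cannot have arbitrary coordinates \<open>f \<bullet> x\<close>, but prescribing the coordinates
  on a basis contained in \<open>F\<close> determines the other \<open>n - d\<close> ones. A basis with largest
  determinant keeps these dependent coordinates small: by Cramer's rule a dual basis vector has all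
  its coordinates in \<open>[-1, 1]\<close>. Thus at the cost of at most \<open>n - d\<close> \<^emph>\<open>sacrificed\<close>
  coordinates each remaining coordinate has a vector that is \<open>1\<close> there, \<open>0\<close> at the other remaining ones and at most
  \<open>1\<close> in absolute value at the sacrificed ones. This can be repeated inside the remaining
  coordinates, sacrificing a disjoint set every time (\<open>bounded_dual_vectors\<close>). The average of
  \<open>q\<close> such vectors still equals \<open>1\<close> at its coordinate, but is at most \<open>1 / q\<close> on each of the
  sacrificed ones (\<open>spread_dual_vectors\<close>).

  With \<open>q = 2 * l\<close>, a sum of \<open>l\<close> of these averages is at most \<open>1 / 2\<close> on the sacrificed
  coordinates, and it is the indicator of an \<open>l\<close>-set on the others. Two such sums for different
  \<open>l\<close>-sets therefore have distance exactly \<open>1\<close>, which gives an equilateral set of size at least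
  \<open>(n - 2 * l * (n - d)) choose l\<close> (\<open>equilateral_set_of_maximum_norm\<close>). For \<open>l = 2\<close> this is
  \<open>m choose 2\<close> with \<open>m = 4 * d - 3 * n\<close>, and the bound on the number of facet pairs makes \<open>m\<close> at least
  the positive root of \<open>t * (t - 1) = 2 * (d + 1)\<close>, so that \<open>m choose 2 \<ge> d + 1\<close>.
\<close>

section \<open>Dual vectors with small coordinates\<close>

lemma det_nonzero_iff_kernel:
  fixes A :: "real ^ 'n ^ 'n"
  shows "det A \<noteq> 0 \<longleftrightarrow> (\<forall>x. A *v x = 0 \<longrightarrow> x = 0)"
  by (metis invertible_det_nz invertible_left_inverse matrix_left_invertible_ker)

lemma spanning_set_contains_basis_matrix:
  fixes F :: "(real ^ 'n) set"
  assumes "span F = UNIV"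
  obtains g where "range g \<subseteq> F" "det (\<chi> i. g i :: real ^ 'n ^ 'n) \<noteq> 0"
proof -
  obtain B where B: "B \<subseteq> F" "independent B" "F \<subseteq> span B" "card B = dim F"
    using basis_exists by blast
  have "dim F = CARD('n)"
    using assms dim_eq_full[of F] by simp
  moreover have "finite B"
    using B(2) by (rule independent_imp_finite)
  ultimately obtain g where g: "bij_betw g (UNIV :: 'n set) B"
    using B(4) by (metis finite_same_card_bij finite_class.finite_UNIV)
  have spanB: "span B = UNIV"
    by (metis B(3) assms span_mono span_span top.extremum_uniqueI)
  have "det (\<chi> i. g i :: real ^ 'n ^ 'n) \<noteq> 0"
    unfolding det_nonzero_iff_kernel
  proof (intro allI impI)
    fix x :: "real ^ 'n"
    assume x: "(\<chi> i. g i) *v x = 0"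
    have "orthogonal x b" if b: "b \<in> B" for b
    proof -
      obtain i where "b = g i"
        using g b by (auto simp: bij_betw_def)
      moreover have "((\<chi> i. g i) *v x) $ i = 0"
        using x by simp
      ultimately show ?thesis
        by (simp add: matrix_vector_mul_component orthogonal_def inner_commute)
    qed
    then have "orthogonal x x"
      using spanB by (metis UNIV_I orthogonal_to_span)
    then show "x = 0"
      by (simp add: orthogonal_self)
  qed
  moreover have "range g \<subseteq> F"
    using g B(1) by (auto simp: bij_betw_def)
  ultimately show ?thesis
    using that by blast
qed

text \<open>Cramer's rule for a dual vector: subtracting \<open>(f \<bullet> x) *\<^sub>R g k\<close> from the new row \<open>f\<close> makes
  all rows orthogonal to \<open>x\<close>, and so the remaining determinant vanishes.\<close>

lemma det_replace_row_by_dual_vector: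
  fixes g :: "'n::finite \<Rightarrow> real ^ 'n"
  assumes dual: "\<And>i. g i \<bullet> x = (if i = k then 1 else 0)"
  shows "det (\<chi> i. (g(k := f)) i) = (f \<bullet> x) * det (\<chi> i. g i)"
proof -
  define r where "r = f - (f \<bullet> x) *s g k"
  have "x \<noteq> 0"
    using dual[of k] by auto
  have r0: "r \<bullet> x = 0"
    using dual[of k] by (simp add: r_def inner_diff_left scalar_mult_eq_scaleR)
  have "(\<chi> i. if i = k then r else g i) *v x = 0"
    using r0 dual by (simp add: vec_eq_iff matrix_vector_mul_component)
  then have "det (\<chi> i. if i = k then r else g i) = 0"
    using \<open>x \<noteq> 0\<close> det_nonzero_iff_kernel by blast
  moreover have "(\<chi> i. (g(k := f)) i) = (\<chi> i. if i = k then r + (f \<bullet> x) *s g k else g i)"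
    by (simp add: vec_eq_iff r_def)
  moreover have "(\<chi> i. if i = k then g k else g i) = (\<chi> i. g i)"
    by (simp add: vec_eq_iff)
  ultimately show ?thesis
    using det_row_add[of k "\<lambda>i. r" "\<lambda>i. (f \<bullet> x) *s g k" g]
      det_row_mul[of k "f \<bullet> x" "\<lambda>i. g k" g]
    by simp
qed

text \<open>Take a basis in \<open>F\<close> with as many vectors outside \<open>J\<close> as possible and, among these, with
  largest absolute determinant; \<open>B\<close> is the part of \<open>J\<close> that it omits. Replacing \<open>a \<in> J\<close> by another
  vector \<open>f\<close> multiplies the determinant by \<open>f \<bullet> x\<close> for the dual vector \<open>x\<close> of \<open>a\<close>. If \<open>f\<close> lies
  outside \<open>J\<close>, the first criterion forces \<open>f \<bullet> x = 0\<close>; if \<open>f\<close> lies in \<open>J\<close>, the second one forces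
  \<open>\<bar>f \<bullet> x\<bar> \<le> 1\<close>.\<close>

lemma bounded_dual_vectors:
  fixes F :: "(real ^ 'n) set"
  assumes "finite F" and "span F = UNIV" and "J \<subseteq> F"
  obtains B where "B \<subseteq> J" "card B + CARD('n) \<le> card F"
    "\<And>a. a \<in> J - B \<Longrightarrow> \<exists>x. a \<bullet> x = 1 \<and> (\<forall>f\<in>B. \<bar>f \<bullet> x\<bar> \<le> 1) \<and> (\<forall>f\<in>F - B - {a}. f \<bullet> x = 0)"
proof -
  define D :: "('n \<Rightarrow> real ^ 'n) \<Rightarrow> real" where "D g = det (\<chi> i. g i)" for g
  define cnt where "cnt g = card {i. g i \<notin> J}" for g :: "'n \<Rightarrow> real ^ 'n"
  define G where "G = {g. range g \<subseteq> F \<and> D g \<noteq> 0}"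
  have "finite {g :: 'n \<Rightarrow> real ^ 'n. range g \<subseteq> F}"
    using finite_PiE[of "UNIV :: 'n set" "\<lambda>_. F"] \<open>finite F\<close>
    by (simp add: PiE_UNIV_domain Pi_def image_subset_iff)
  then have "finite G"
    by (rule rev_finite_subset) (auto simp: G_def)
  obtain b :: "'n \<Rightarrow> real ^ 'n" where "range b \<subseteq> F" "det (\<chi> i. b i) \<noteq> 0"
    using assms(2) by (rule spanning_set_contains_basis_matrix)
  then have "b \<in> G"
    by (simp add: G_def D_def)
  then have "G \<noteq> {}"
    by blast
  then obtain g0 where g0: "g0 \<in> G" "Max (cnt ` G) = cnt g0"
    using obtains_MAX[OF \<open>finite G\<close>, of cnt] by blast
  then have cnt_max: "cnt h \<le> cnt g0" if "h \<in> G" for h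
    using Max_ge[of "cnt ` G" "cnt h"] that \<open>finite G\<close> by simp
  define G' where "G' = {g \<in> G. cnt g = cnt g0}"
  have "finite G'" "G' \<noteq> {}"
    using \<open>finite G\<close> g0 by (auto simp: G'_def)
  then obtain g where g: "g \<in> G'" "Max ((\<lambda>g. \<bar>D g\<bar>) ` G') = \<bar>D g\<bar>"
    using obtains_MAX[of G' "\<lambda>g. \<bar>D g\<bar>"] by blast
  then have D_max: "\<bar>D h\<bar> \<le> \<bar>D g\<bar>" if "h \<in> G'" for h
    using Max_ge[of "(\<lambda>g. \<bar>D g\<bar>) ` G'" "\<bar>D h\<bar>"] that \<open>finite G'\<close> by simp
  have gG: "g \<in> G" "range g \<subseteq> F" "D g \<noteq> 0" and cnt_g: "cnt g = cnt g0"
    using g by (auto simp: G_def G'_def)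

  have dual: "\<exists>x. \<forall>i. g i \<bullet> x = (if i = k then 1 else 0)" for k
  proof -
    have "invertible (\<chi> i. g i)"
      using gG(3) by (simp add: D_def invertible_det_nz)
    then have "surj ((*v) (\<chi> i. g i))"
      using invertible_right_inverse matrix_right_invertible_surjective by blast
    then obtain x where "axis k 1 = (\<chi> i. g i) *v x"
      by (rule surjE)
    then have "((\<chi> i. g i) *v x) $ i = axis k 1 $ i" for i
      by simp
    then have "g i \<bullet> x = (if i = k then 1 else 0)" for i
      by (simp add: matrix_vector_mul_component axis_def)
    then show ?thesis
      by blast
  qed
  have "inj g"
  proof (rule injI)
    fix i j
    assume "g i = g j"
    moreover obtain x where "\<forall>l. g l \<bullet> x = (if l = i then 1 else 0)"
      using dual by blast
    ultimately have "(if j = i then 1 else 0) = (1::real)"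
      by (metis (full_types))
    then show "i = j"
      by (simp split: if_splits)
  qed

  show thesis
  proof (rule that[of "J - range g"])
    show "J - range g \<subseteq> J"
      by blast
    have "card (J - range g) \<le> card (F - range g)"
      using assms by (intro card_mono) auto
    also have "\<dots> = card F - CARD('n)"
      using gG(2) \<open>inj g\<close> by (simp add: card_Diff_subset card_image)
    finally show "card (J - range g) + CARD('n) \<le> card F"
      using card_mono[OF \<open>finite F\<close> gG(2)] \<open>inj g\<close> by (simp add: card_image)
  next
    fix a
    assume a: "a \<in> J - (J - range g)"
    then obtain k where k: "a = g k"
      by blast
    obtain x where x: "\<And>i. g i \<bullet> x = (if i = k then 1 else 0)"
      using dual by blast
    have swap: "D (g(k := f)) = (f \<bullet> x) * D g" for f
      unfolding D_def using x by (rule det_replace_row_by_dual_vector)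
    have swapG: "g(k := f) \<in> G" if "f \<in> F" "f \<bullet> x \<noteq> 0" for f
      using that gG swap by (auto simp: G_def)
    have out0: "f \<bullet> x = 0" if "f \<in> F - J" for f
    proof (rule ccontr)
      assume "f \<bullet> x \<noteq> 0"
      then have "cnt (g(k := f)) \<le> cnt g"
        using swapG that cnt_max cnt_g by simp
      moreover have "{i. (g(k := f)) i \<notin> J} = insert k {i. g i \<notin> J}"
        using that a k by auto
      moreover have "k \<notin> {i. g i \<notin> J}"
        using a k by auto
      ultimately show False
        by (simp add: cnt_def)
    qed
    have in1: "\<bar>f \<bullet> x\<bar> \<le> 1" if "f \<in> J" for f
    proof (cases "f \<bullet> x = 0")
      case False
      have "{i. (g(k := f)) i \<notin> J} = {i. g i \<notin> J}"
        using that a k by auto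
      then have "g(k := f) \<in> G'"
        using swapG[of f] that False \<open>J \<subseteq> F\<close> cnt_g by (auto simp: G'_def cnt_def)
      then have "\<bar>f \<bullet> x\<bar> * \<bar>D g\<bar> \<le> 1 * \<bar>D g\<bar>"
        using D_max[of "g(k := f)"] swap by (simp add: abs_mult)
      then show ?thesis
        using gG(3) by simp
    qed simp
    have "f \<bullet> x = 0" if "f \<in> F - (J - range g) - {a}" for f
      using that out0 x k by (cases "f \<in> J") auto
    then show "\<exists>x. a \<bullet> x = 1 \<and> (\<forall>f\<in>J - range g. \<bar>f \<bullet> x\<bar> \<le> 1) \<and>
        (\<forall>f\<in>F - (J - range g) - {a}. f \<bullet> x = 0)"
      using x[of k] k in1 by (intro exI[of _ x]) auto
  qed
qed

text \<open>The vector for \<open>a\<close> is the sum of the dual vectors from \<open>q\<close> successive rounds. Each round is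
  applied to the coordinates that are left and is nonzero, apart from \<open>a\<close>, only at those it
  removes; so every coordinate outside \<open>M\<close> is touched in a single round, and the bound \<open>1\<close> does not
  grow with \<open>q\<close>.\<close>

lemma spread_dual_vectors:
  fixes F :: "(real ^ 'n) set"
  assumes "finite F" and "span F = UNIV"
  shows "\<exists>M z. M \<subseteq> F \<and> card F \<le> card M + q * (card F - CARD('n)) \<and>
    (\<forall>a\<in>M. a \<bullet> z a = real q \<and> (\<forall>f\<in>M - {a}. f \<bullet> z a = 0) \<and> (\<forall>f\<in>F - M. \<bar>f \<bullet> z a\<bar> \<le> 1))"
proof (induction q)
  case 0
  show ?case
    by (intro exI[of _ F] exI[of _ "\<lambda>_. 0"]) simp
next
  case (Suc q)
  then obtain M z where M: "M \<subseteq> F" "card F \<le> card M + q * (card F - CARD('n))"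
    and z: "\<And>a. a \<in> M \<Longrightarrow> a \<bullet> z a = real q" "\<And>a f. a \<in> M \<Longrightarrow> f \<in> M - {a} \<Longrightarrow> f \<bullet> z a = 0"
      "\<And>a f. a \<in> M \<Longrightarrow> f \<in> F - M \<Longrightarrow> \<bar>f \<bullet> z a\<bar> \<le> 1"
    by blast
  obtain B where B: "B \<subseteq> M" "card B + CARD('n) \<le> card F"
    and "\<And>a. a \<in> M - B \<Longrightarrow>
      \<exists>x. a \<bullet> x = 1 \<and> (\<forall>f\<in>B. \<bar>f \<bullet> x\<bar> \<le> 1) \<and> (\<forall>f\<in>F - B - {a}. f \<bullet> x = 0)"
    using bounded_dual_vectors[OF assms M(1)] by blast
  then obtain x where x: "\<And>a. a \<in> M - B \<Longrightarrow> a \<bullet> x a = 1"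
      "\<And>a f. a \<in> M - B \<Longrightarrow> f \<in> B \<Longrightarrow> \<bar>f \<bullet> x a\<bar> \<le> 1"
      "\<And>a f. a \<in> M - B \<Longrightarrow> f \<in> F - B - {a} \<Longrightarrow> f \<bullet> x a = 0"
    by metis
  have "finite M"
    using M(1) assms(1) by (rule finite_subset)
  then have "card M \<le> card (M - B) + (card F - CARD('n))"
    using B by (simp add: card_Diff_subset finite_subset)
  then have "card F \<le> card (M - B) + Suc q * (card F - CARD('n))"
    using M(2) by simp
  moreover have "a \<bullet> (z a + x a) = real (Suc q)" if "a \<in> M - B" for a
    using that z(1) x(1) by (simp add: inner_add_right)
  moreover have "f \<bullet> (z a + x a) = 0" if "a \<in> M - B" "f \<in> (M - B) - {a}" for a f
    using that z(2)[of a f] x(3)[of a f] M(1) by (auto simp: inner_add_right)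
  moreover have "\<bar>f \<bullet> (z a + x a)\<bar> \<le> 1" if "a \<in> M - B" "f \<in> F - (M - B)" for a f
  proof (cases "f \<in> B")
    case True
    then have "f \<bullet> z a = 0"
      using that z(2)[of a f] B(1) by blast
    then show ?thesis
      using True that x(2) by (simp add: inner_add_right)
  next
    case False
    then have "f \<bullet> x a = 0" "\<bar>f \<bullet> z a\<bar> \<le> 1"
      using that x(3)[of a f] z(3)[of a f] by auto
    then show ?thesis
      by (simp add: inner_add_right)
  qed
  ultimately show ?case
    using M(1) by (intro exI[of _ "M - B"] exI[of _ "\<lambda>a. z a + x a"]) auto
qed

section \<open>Equilateral sets for maxima of linear functionals\<close>

text \<open>The points are the imitations of the cube vertices given by the indicators of \<open>l\<close>-subsets.\<close>

lemma equilateral_set_of_maximum_norm: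
  fixes F :: "(real ^ 'n) set"
  assumes "finite F" and "span F = UNIV" and "l \<ge> 1"
    and upper: "\<And>f x. f \<in> F \<Longrightarrow> \<bar>f \<bullet> x\<bar> \<le> N x"
    and attained: "\<And>x. \<exists>f\<in>F. N x = \<bar>f \<bullet> x\<bar>"
  obtains S where "finite S" "c_equilateral N 1 S"
    "card S \<ge> (card F - 2 * l * (card F - CARD('n))) choose l"
proof -
  obtain M z where M: "M \<subseteq> F" "card F \<le> card M + (2 * l) * (card F - CARD('n))"
    and z: "\<And>a. a \<in> M \<Longrightarrow> a \<bullet> z a = real (2 * l)"
      "\<And>a f. a \<in> M \<Longrightarrow> f \<in> M - {a} \<Longrightarrow> f \<bullet> z a = 0"
      "\<And>a f. a \<in> M \<Longrightarrow> f \<in> F - M \<Longrightarrow> \<bar>f \<bullet> z a\<bar> \<le> 1"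
    using spread_dual_vectors[OF assms(1,2), of "2 * l"] by blast
  define T where "T = {A. A \<subseteq> M \<and> card A = l}"
  define p where "p A = (1 / real (2 * l)) *\<^sub>R (\<Sum>a\<in>A. z a)" for A
  have "finite M"
    using M(1) assms(1) by (rule finite_subset)
  have "finite T"
    using \<open>finite M\<close> by (simp add: T_def)
  have inner_p: "f \<bullet> p A = (\<Sum>a\<in>A. f \<bullet> z a) / real (2 * l)" for f A
    by (simp add: p_def inner_sum_right)
  have on_M: "f \<bullet> p A = (if f \<in> A then 1 else 0)" if "A \<in> T" "f \<in> M" for A f
  proof -
    have A: "A \<subseteq> M" "finite A"
      using that \<open>finite M\<close> by (auto simp: T_def intro: finite_subset)
    have "(\<Sum>a\<in>A. f \<bullet> z a) = (\<Sum>a\<in>A. if a = f then real (2 * l) else 0)"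
      using A that z(1,2) by (intro sum.cong) auto
    also have "\<dots> = (if f \<in> A then real (2 * l) else 0)"
      using A(2) by (simp add: sum.delta)
    finally show ?thesis
      using \<open>l \<ge> 1\<close> by (simp add: inner_p)
  qed
  have off_M: "\<bar>f \<bullet> p A\<bar> \<le> 1 / 2" if "A \<in> T" "f \<in> F - M" for A f
  proof -
    have "\<bar>\<Sum>a\<in>A. f \<bullet> z a\<bar> \<le> (\<Sum>a\<in>A. \<bar>f \<bullet> z a\<bar>)"
      by (rule sum_abs)
    also have "\<dots> \<le> (\<Sum>a\<in>A. 1)"
      using that z(3) by (intro sum_mono) (auto simp: T_def)
    also have "\<dots> = real l"
      using that by (simp add: T_def)
    finally show ?thesis
      using \<open>l \<ge> 1\<close> by (simp add: inner_p field_simps)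
  qed
  have dist: "N (p A - p A') = 1" if T: "A \<in> T" "A' \<in> T" and "A \<noteq> A'" for A A'
  proof -
    have "\<bar>f \<bullet> (p A - p A')\<bar> \<le> 1" if "f \<in> F" for f
    proof (cases "f \<in> M")
      case True
      then show ?thesis
        using T on_M by (simp add: inner_diff_right)
    next
      case False
      then show ?thesis
        using off_M[OF T(1), of f] off_M[OF T(2), of f] that by (simp add: inner_diff_right)
    qed
    then have "N (p A - p A') \<le> 1"
      using attained by metis
    moreover obtain f where f: "f \<in> M" "(f \<in> A) \<noteq> (f \<in> A')"
      using T \<open>A \<noteq> A'\<close> by (auto simp: T_def)
    then have "\<bar>f \<bullet> (p A - p A')\<bar> = 1"
      using T on_M by (auto simp: inner_diff_right)
    ultimately show ?thesis
      using upper[of f "p A - p A'"] f M(1) by auto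
  qed
  have "N 0 = 0"
    using attained[of 0] by simp
  then have "inj_on p T"
    using dist by (intro inj_onI) (metis diff_self zero_neq_one)
  then have "card (p ` T) = card M choose l"
    using n_subsets[OF \<open>finite M\<close>] by (simp add: card_image T_def)
  moreover have "(card F - 2 * l * (card F - CARD('n))) choose l \<le> card M choose l"
    using M(2) by (intro binomial_right_mono) simp
  moreover have "c_equilateral N 1 (p ` T)"
    using dist by (auto simp: c_equilateral_def)
  ultimately show thesis
    using that[of "p ` T"] \<open>finite T\<close> by simp
qed

section \<open>Facet normals of a polytopal norm\<close>

text \<open>A facet \<open>c\<close> is exposed by some \<open>a \<bullet> x = b\<close>. Here \<open>b \<ge> 0\<close> because \<open>0\<close> lies in \<open>P\<close>, and
  \<open>b = 0\<close> would by symmetry put all of \<open>P\<close> into the hyperplane, hence into \<open>c\<close>. So the equation can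
  be rescaled to right-hand side \<open>1\<close>.\<close>

lemma symmetric_polyhedron_facet_normal:
  fixes P :: "'a::euclidean_space set"
  assumes "polyhedron P" and "0 \<in> P" and sym: "\<And>x. x \<in> P \<Longrightarrow> - x \<in> P" and c: "c facet_of P"
  obtains f where "\<And>x. x \<in> P \<Longrightarrow> f \<bullet> x \<le> 1" "c = P \<inter> {x. f \<bullet> x = 1}"
proof -
  have "c exposed_face_of P"
    using c exposed_face_of_polyhedron[OF assms(1)] by (simp add: facet_of_def)
  then obtain a b where ab: "P \<subseteq> {x. a \<bullet> x \<le> b}" "c = P \<inter> {x. a \<bullet> x = b}"
    by (auto simp: exposed_face_of_def)
  have "b \<ge> 0"
    using ab(1) \<open>0 \<in> P\<close> by auto
  moreover have "b \<noteq> 0"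
  proof
    assume "b = 0"
    then have "a \<bullet> x = 0" if "x \<in> P" for x
      using subsetD[OF ab(1) that] subsetD[OF ab(1) sym[OF that]] \<open>b = 0\<close> by simp
    then have "c = P"
      using ab(2) \<open>b = 0\<close> by auto
    then show False
      using c by (simp add: facet_of_def)
  qed
  ultimately have "b > 0"
    by simp
  show thesis
  proof (rule that[of "a /\<^sub>R b"])
    show "(a /\<^sub>R b) \<bullet> x \<le> 1" if "x \<in> P" for x
      using that ab(1) \<open>b > 0\<close> by (auto simp: field_simps)
    show "c = P \<inter> {x. (a /\<^sub>R b) \<bullet> x = 1}"
      using ab(2) \<open>b > 0\<close> by (auto simp: field_simps)
  qed
qed

lemma is_norm_minus: "is_norm N \<Longrightarrow> N (- x) = N x"
  unfolding is_norm_def by (metis abs_minus_cancel abs_one mult_1 scaleR_minus1_left)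

text \<open>A unit vector \<open>y\<close> is not in the relative interior of the ball, since the ball does not
  extend beyond \<open>y\<close> on the ray from \<open>0\<close>; and the relative boundary is the union of the facets.\<close>

lemma unit_vector_in_facet:
  fixes N :: "'a::euclidean_space \<Rightarrow> real"
  assumes "is_norm N" and "polyhedron (norm_unit_ball N)" and "N y = 1"
  obtains c where "c facet_of norm_unit_ball N" "y \<in> c"
proof -
  let ?P = "norm_unit_ball N"
  have N0: "N 0 = 0" and hom: "\<And>a x. N (a *\<^sub>R x) = \<bar>a\<bar> * N x"
    using assms(1) by (auto simp: is_norm_def)
  then have "0 \<in> ?P" "y \<in> ?P"
    using assms(3) by (auto simp: norm_unit_ball_def)
  have "y \<notin> rel_interior ?P"
  proof
    assume "y \<in> rel_interior ?P"
    then obtain e where "e > 1" "(1 - e) *\<^sub>R 0 + e *\<^sub>R y \<in> ?P"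
      using convex_rel_interior_iff[OF polyhedron_imp_convex[OF assms(2)]] \<open>0 \<in> ?P\<close> by blast
    then show False
      using hom assms(3) by (simp add: norm_unit_ball_def)
  qed
  then show thesis
    using that rel_boundary_of_polyhedron[OF assms(2)] \<open>y \<in> ?P\<close> by blast
qed

text \<open>The vector chosen for a pair \<open>{c, - c}\<close> exposes one of these two facets; its negative serves
  the other one. It therefore takes the value \<open>\<plusminus>1\<close> on the whole pair.\<close>

lemma facet_normals_of_unit_ball:
  fixes N :: "'a::euclidean_space \<Rightarrow> real"
  assumes N: "is_norm N" and poly: "polyhedron (norm_unit_ball N)"
  obtains F where "finite F" "card F \<le> card (opposite_facet_pairs (norm_unit_ball N))"
    "\<And>f x. f \<in> F \<Longrightarrow> \<bar>f \<bullet> x\<bar> \<le> N x" "\<And>x. \<exists>f\<in>F. N x = \<bar>f \<bullet> x\<bar>"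
proof -
  define P where "P = norm_unit_ball N"
  define Q where "Q = opposite_facet_pairs P"
  have N0: "N x = 0 \<longleftrightarrow> x = 0" and hom: "N (a *\<^sub>R x) = \<bar>a\<bar> * N x" and nonneg: "0 \<le> N x" for a x
    using N by (auto simp: is_norm_def)
  have "N 0 = 0"
    by (simp only: N0)
  then have P: "polyhedron P" "0 \<in> P"
    using poly by (simp_all add: P_def norm_unit_ball_def)
  have sym: "- x \<in> P" if "x \<in> P" for x
    using that is_norm_minus[OF N] by (simp add: P_def norm_unit_ball_def)
  have normalize: "N (x /\<^sub>R N x) = 1" if "x \<noteq> 0" for x
    using that N0[of x] nonneg[of x] by (simp add: hom)
  have "finite Q"
  proof -
    have "Q = (\<lambda>c. {c, uminus ` c}) ` {c. c facet_of P}"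
      by (auto simp: Q_def opposite_facet_pairs_def)
    then show ?thesis
      using finite_polyhedron_facets[OF P(1)] by simp
  qed

  define R where "R q f \<longleftrightarrow> (\<forall>x\<in>P. f \<bullet> x \<le> 1) \<and>
    (\<exists>c. q = {c, uminus ` c} \<and> c = P \<inter> {x. f \<bullet> x = 1})" for q f
  have "\<exists>f. R q f" if q: "q \<in> Q" for q
  proof -
    obtain c where c: "c facet_of P" "q = {c, uminus ` c}"
      using q by (auto simp: Q_def opposite_facet_pairs_def)
    obtain f where "\<And>x. x \<in> P \<Longrightarrow> f \<bullet> x \<le> 1" "c = P \<inter> {x. f \<bullet> x = 1}"
      using symmetric_polyhedron_facet_normal[OF P sym c(1)] by blast
    then show ?thesis
      unfolding R_def using c(2) by blast
  qed
  then obtain \<phi> where \<phi>: "\<And>q. q \<in> Q \<Longrightarrow> R q (\<phi> q)"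
    by metis

  have unit_attained: "\<exists>f\<in>\<phi> ` Q. \<bar>f \<bullet> y\<bar> = 1" if y: "N y = 1" for y
  proof -
    obtain c where c: "c facet_of P" "y \<in> c"
      using unit_vector_in_facet[OF N poly y] unfolding P_def by blast
    then have q: "{c, uminus ` c} \<in> Q"
      by (auto simp: Q_def opposite_facet_pairs_def)
    define q where "q = {c, uminus ` c}"
    obtain c' where c': "{c, uminus ` c} = {c', uminus ` c'}" "c' = P \<inter> {x. \<phi> q \<bullet> x = 1}"
      using \<phi> q unfolding R_def q_def by blast
    have "c = c' \<or> c = uminus ` c'"
      using c'(1) by (metis doubleton_eq_iff)
    then have "y \<in> c' \<or> - y \<in> c'"
      using c(2) by auto
    then have "\<phi> q \<bullet> y = 1 \<or> \<phi> q \<bullet> (- y) = 1"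
      using c'(2) by blast
    then have "\<bar>\<phi> q \<bullet> y\<bar> = 1"
      by auto
    then show ?thesis
      using q unfolding q_def by blast
  qed
  have upper: "\<bar>f \<bullet> x\<bar> \<le> N x" if "f \<in> \<phi> ` Q" for f x
  proof (cases "x = 0")
    case False
    have "x /\<^sub>R N x \<in> P"
      using normalize[OF False] by (simp add: P_def norm_unit_ball_def)
    then have "f \<bullet> (x /\<^sub>R N x) \<le> 1" "f \<bullet> (- (x /\<^sub>R N x)) \<le> 1"
      using that \<phi> sym unfolding R_def by blast+
    moreover have "N x > 0"
      using False N0[of x] nonneg[of x] by simp
    ultimately show ?thesis
      by (simp add: field_simps abs_le_iff)
  qed (simp add: nonneg)
  have attained: "\<exists>f\<in>\<phi> ` Q. N x = \<bar>f \<bullet> x\<bar>" for x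
  proof (cases "x = 0")
    case True
    \<comment> \<open>Any nonzero vector shows that there is a facet at all.\<close>
    obtain b :: 'a where "b \<noteq> 0"
      using nonzero_Basis SOME_Basis by blast
    then show ?thesis
      using unit_attained[OF normalize[OF \<open>b \<noteq> 0\<close>]] True \<open>N 0 = 0\<close> by auto
  next
    case False
    then obtain f where f: "f \<in> \<phi> ` Q" "\<bar>f \<bullet> (x /\<^sub>R N x)\<bar> = 1"
      using unit_attained[OF normalize[OF False]] by blast
    moreover have "N x > 0"
      using False N0[of x] nonneg[of x] by simp
    ultimately have "N x = \<bar>f \<bullet> x\<bar>"
      by (simp add: abs_mult field_simps)
    then show ?thesis
      using f(1) by blast
  qed
  show thesis
    using that[of "\<phi> ` Q"] \<open>finite Q\<close> card_image_le[OF \<open>finite Q\<close>, of \<phi>] upper attained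
    by (auto simp: Q_def P_def)
qed

lemma span_UNIV_of_norm_functionals:
  fixes F :: "'a::euclidean_space set"
  assumes "is_norm N" and attained: "\<And>x. \<exists>f\<in>F. N x = \<bar>f \<bullet> x\<bar>"
  shows "span F = UNIV"
proof (rule ccontr)
  assume "span F \<noteq> UNIV"
  then have "dim F < DIM('a)"
    using dim_eq_full[of F] dim_subset_UNIV[of F] by simp
  then obtain x where x: "x \<noteq> 0" "\<And>y. y \<in> span F \<Longrightarrow> orthogonal x y"
    using orthogonal_to_subspace_exists by blast
  then have "N x = 0"
    using attained[of x] by (auto simp: span_base orthogonal_def inner_commute)
  then show False
    using assms(1) x(1) by (simp add: is_norm_def)
qed

section \<open>The bound for few facets\<close>

lemma choose_two_ge_if_root_le:
  assumes "real m \<ge> (1 + sqrt (8 * real d + 9)) / 2"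
  shows "m choose 2 \<ge> d + 1"
proof -
  have "sqrt (8 * real d + 9) \<le> 2 * real m - 1"
    using assms by simp
  then have "8 * real d + 9 \<le> (2 * real m - 1)\<^sup>2"
    by (rule sqrt_le_D)
  then have "real (2 * (d + 1) + m) \<le> real (m * m)"
    by (simp add: power2_eq_square algebra_simps)
  then have "2 * (d + 1) + m \<le> m * m"
    by (simp only: of_nat_le_iff)
  then have "2 * (d + 1) \<le> m * (m - 1)"
    by (simp add: diff_mult_distrib2)
  then show ?thesis
    by (simp add: choose_two)
qed

theorem corollary1:
  fixes P :: "(real ^ 'n) set" and N :: "real ^ 'n \<Rightarrow> real" and d :: nat
  assumes "d = CARD('n)" and "d \<ge> 1"
    and "polytope P" and "origin_symmetric P"
    and "real (card (opposite_facet_pairs P)) \<le> 4 * real d / 3 - (1 + sqrt (8 * real d + 9)) / 6"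
    and "is_norm N" and "norm_unit_ball N = P"
  shows "equilateral_number N \<ge> enat (d + 1)"
proof -
  have "polyhedron (norm_unit_ball N)"
    using assms(3,7) polytope_imp_polyhedron by simp
  then obtain F where F: "finite F" "card F \<le> card (opposite_facet_pairs P)"
    and upper: "\<And>f x. f \<in> F \<Longrightarrow> \<bar>f \<bullet> x\<bar> \<le> N x" and attained: "\<And>x. \<exists>f\<in>F. N x = \<bar>f \<bullet> x\<bar>"
    using facet_normals_of_unit_ball[OF assms(6)] assms(7) by metis
  have span: "span F = UNIV"
    using assms(6) attained by (rule span_UNIV_of_norm_functionals)
  have "d \<le> card F"
    using span_card_ge_dim[of F UNIV] span F(1) assms(1) by simp
  define m where "m = card F - 2 * 2 * (card F - d)"
  have "(1 + sqrt (8 * real d + 9)) / 2 \<le> 4 * real d - 3 * real (card F)"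
    using F(2) assms(5) by linarith
  also have "\<dots> \<le> real m"
    using \<open>d \<le> card F\<close> unfolding m_def by linarith
  finally have "d + 1 \<le> m choose 2"
    by (rule choose_two_ge_if_root_le)
  moreover obtain S where S: "finite S" "c_equilateral N 1 S" "m choose 2 \<le> card S"
    using equilateral_set_of_maximum_norm[OF F(1) span _ upper attained, of 2] assms(1)
    by (auto simp: m_def)
  ultimately have "enat (d + 1) \<le> enat (card S)"
    by simp
  also have "\<dots> \<le> equilateral_number N"
    unfolding equilateral_number_def
  proof (rule SUP_upper)
    show "S \<in> {S. finite S \<and> equilateral N S}"
      using S unfolding equilateral_def by (auto intro: exI[of _ 1])
  qed
  finally show ?thesis .
qed

end
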